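(* Let $\mathrm{Sol}$ be the simply connected three dimensional Lie group whose Lie algebra $\mathfrak{sol}$ has the basis $\mathbb{B}_0=(X_1,X_2,X_3)$ with $[X_1,X_2]=X_2$, $[X_1,X_3]=-X_3$, $[X_2,X_3]=0$. Then any Lorentzian left invariant metric on $\mathrm{Sol}$ is isometric, via an automorphism of $\mathrm{Sol}$, to a left invariant metric whose matrix in $\mathbb{B}_0$ is of one of the following seven forms (all parameters real): (1) $\begin{pmatrix}\frac4{u^2-v^2}&0&0\\0&1&\frac uv\\0&\frac uv&1\end{pmatrix}$ with $v>0$, $u<v$; (2) $\begin{pmatrix}\frac4{v^2-u^2}&0&0\\0&\frac uv&-1\\0&-1&\frac uv\end{pmatrix}$ with $v>0$, $u<v$; (3) $\begin{pmatrix}\frac1{u+v}&0&0\\0&-\frac vu&1\\0&1&1\end{pmatrix}$ with $u>0$, $v>0$; (4) $\begin{pmatrix}\frac1u&0&0\\0&-1&0\\0&0&1\end{pmatrix}$ with $u>0$; (5) $\begin{pmatrix}0&0&-\frac2b\\0&1&1\\-\frac2b&1&1\end{pmatrix}$ with $b>0$; (6) $\begin{pmatrix}\lambda^2&0&0\\0&\lambda&1\\0&1&0\end{pmatrix}$ with $\lambda\neq0$; (7) $\begin{pmatrix}0&0&1\\0&1&0\\1&0&0\end{pmatrix}$.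
   Context: A Lorentzian left invariant metric $h$ on a three dimensional Lie group $G$ is identified with a nondegenerate symmetric bilinear form of signature $(+,+,-)$ on the Lie algebra $\mathfrak{g}$; its matrix in a basis $\mathbb{B}_0$ is the Gram matrix of this form. Two left invariant metrics $h_1,h_2$ on $G$ are isometric via an automorphism if there is a Lie group automorphism $\phi$ of $G$ with $h_1=\phi^*h_2$; since $G$ is simply connected, this is equivalent to the existence of a Lie algebra automorphism of $\mathfrak{g}$ pulling back one form to the other. *)

theory Defs
  imports "HOL-Analysis.Analysis" "HOL-Algebra.Group"
begin

section \<open>The Lie group Sol\<close>

text \<open>
  The simply connected three dimensional Lie group Sol is realised on its standard global chart,
  the manifold \<open>real^3\<close>. Every tangent space is thereby identified with \<open>real^3\<close>,
  and the differential of a map is its Frechet derivative.  The lemmas at the end of this theory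
  check that this is a group whose operations are smooth, that the underlying space is simply
  connected, and that the left invariant fields \<open>B0 1\<close>, \<open>B0 2\<close>, \<open>B0 3\<close> satisfy
  the bracket relations of \<open>sol\<close>.
\<close>

definition Sol :: "(real^3) monoid" where
  "Sol = \<lparr> carrier = UNIV,
           monoid.mult = (\<lambda>p q. vector [p$1 + q$1, p$2 + exp (p$1) * q$2, p$3 + exp (- (p$1)) * q$3]),
           one = 0 \<rparr>"

fun k_smooth :: "nat \<Rightarrow> ('a::real_normed_vector \<Rightarrow> 'b::real_normed_vector) \<Rightarrow> bool" where
  "k_smooth 0 f \<longleftrightarrow> continuous_on UNIV f"
| "k_smooth (Suc k) f \<longleftrightarrow>
     (\<forall>x. f differentiable (at x)) \<and> (\<forall>v. k_smooth k (\<lambda>x. frechet_derivative f (at x) v))"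

definition smooth :: "('a::real_normed_vector \<Rightarrow> 'b::real_normed_vector) \<Rightarrow> bool" where
  "smooth f \<longleftrightarrow> (\<forall>k. k_smooth k f)"

text \<open>The left invariant vector field with value \<open>v\<close> at the identity.\<close>

definition left_invariant_field :: "real^3 \<Rightarrow> real^3 \<Rightarrow> real^3" where
  "left_invariant_field v p = frechet_derivative (\<lambda>q. p \<otimes>\<^bsub>Sol\<^esub> q) (at \<one>\<^bsub>Sol\<^esub>) v"

definition B0 :: "3 \<Rightarrow> real^3 \<Rightarrow> real^3" where
  "B0 i = left_invariant_field (axis i 1)"

definition lie_bracket :: "(real^3 \<Rightarrow> real^3) \<Rightarrow> (real^3 \<Rightarrow> real^3) \<Rightarrow> real^3 \<Rightarrow> real^3" where
  "lie_bracket X Y p = frechet_derivative Y (at p) (X p) - frechet_derivative X (at p) (Y p)"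

definition lie_automorphism :: "(real^3 \<Rightarrow> real^3) \<Rightarrow> bool" where
  "lie_automorphism \<phi> \<longleftrightarrow> \<phi> \<in> iso Sol Sol \<and> smooth \<phi> \<and> smooth (inv_into UNIV \<phi>)"


section \<open>Left invariant Lorentzian metrics\<close>

text \<open>A metric assigns to a point \<open>p\<close> and two tangent vectors at \<open>p\<close> a real number.\<close>

type_synonym metric = "real^3 \<Rightarrow> real^3 \<Rightarrow> real^3 \<Rightarrow> real"

text \<open>Symmetric bilinear forms of signature (+,+,-), hence nondegenerate.\<close>

definition lorentzian_form :: "(real^3 \<Rightarrow> real^3 \<Rightarrow> real) \<Rightarrow> bool" where
  "lorentzian_form B \<longleftrightarrow>
     bilinear B \<and> (\<forall>v w. B v w = B w v) \<and>
     (\<exists>e1 e2 e3. span {e1, e2, e3} = UNIV \<and>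
        B e1 e2 = 0 \<and> B e1 e3 = 0 \<and> B e2 e3 = 0 \<and>
        B e1 e1 > 0 \<and> B e2 e2 > 0 \<and> B e3 e3 < 0)"

definition lorentzian_metric :: "metric \<Rightarrow> bool" where
  "lorentzian_metric h \<longleftrightarrow> (\<forall>p. lorentzian_form (h p)) \<and> (\<forall>v w. smooth (\<lambda>p. h p v w))"

definition pullback :: "(real^3 \<Rightarrow> real^3) \<Rightarrow> metric \<Rightarrow> metric" where
  "pullback \<phi> h = (\<lambda>p v w. h (\<phi> p) (frechet_derivative \<phi> (at p) v) (frechet_derivative \<phi> (at p) w))"

definition left_invariant :: "metric \<Rightarrow> bool" where
  "left_invariant h \<longleftrightarrow> (\<forall>a. pullback (\<lambda>q. a \<otimes>\<^bsub>Sol\<^esub> q) h = h)"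

definition isometric_via_automorphism :: "metric \<Rightarrow> metric \<Rightarrow> bool" where
  "isometric_via_automorphism h1 h2 \<longleftrightarrow> (\<exists>\<phi>. lie_automorphism \<phi> \<and> h1 = pullback \<phi> h2)"

text \<open>
  The Gram matrix of \<open>h\<close> in \<open>B0\<close>, with the Lie algebra identified with the tangent
  space at the identity.
\<close>

definition metric_matrix :: "metric \<Rightarrow> real^3^3" where
  "metric_matrix h = (\<chi> i j. h \<one>\<^bsub>Sol\<^esub> (B0 i \<one>\<^bsub>Sol\<^esub>) (B0 j \<one>\<^bsub>Sol\<^esub>))"

definition matrix3 :: "real \<Rightarrow> real \<Rightarrow> real \<Rightarrow> real \<Rightarrow> real \<Rightarrow> real \<Rightarrow> real \<Rightarrow> real \<Rightarrow> real \<Rightarrow> real^3^3" where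
  "matrix3 a b c d e f g h i = vector [vector [a, b, c], vector [d, e, f], vector [g, h, i]]"

section \<open>Checks on the model of Sol\<close>

lemma exp_minus_add: "exp (- a - b) = exp (- a) * exp (- b)" for a b :: real
  by (simp flip: exp_add)

lemma group_Sol: "group Sol"
proof (rule groupI)
  fix x assume "x \<in> carrier Sol"
  show "\<exists>y\<in>carrier Sol. y \<otimes>\<^bsub>Sol\<^esub> x = \<one>\<^bsub>Sol\<^esub>"
    by (rule bexI[where x="vector [- (x$1), - (exp (- (x$1)) * x$2), - (exp (x$1) * x$3)]"])
       (simp_all add: Sol_def vec_eq_iff forall_3)
qed (simp_all add: Sol_def vec_eq_iff forall_3 exp_add exp_minus_add distrib_left)

lemma inv_Sol: "inv\<^bsub>Sol\<^esub> p = vector [- (p$1), - (exp (- (p$1)) * p$2), - (exp (p$1) * p$3)]"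
  by (rule group.inv_equality[OF group_Sol]) (simp_all add: Sol_def vec_eq_iff forall_3)

lemma simply_connected_Sol: "simply_connected (carrier Sol)"
  by (simp add: Sol_def convex_imp_simply_connected)

lemma has_derivative_vec3:
  fixes f :: "'a::real_normed_vector \<Rightarrow> real^3"
  assumes "\<And>i. ((\<lambda>x. f x $ i) has_derivative (\<lambda>v. f' v $ i)) (at x)"
  shows "(f has_derivative f') (at x)"
  by (subst has_derivative_componentwise_within)
     (auto simp: Basis_vec_def inner_axis assms)

lemma frechet_mult:
  "frechet_derivative (\<lambda>q. p \<otimes>\<^bsub>Sol\<^esub> q) (at q) v
     = vector [v$1, exp (p$1) * v$2, exp (- (p$1)) * v$3]"
proof -
  have "((\<lambda>q. p \<otimes>\<^bsub>Sol\<^esub> q) has_derivative (\<lambda>v. vector [v$1, exp (p$1) * v$2, exp (- (p$1)) * v$3])) (at q)"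
    apply (rule has_derivative_vec3)
    subgoal for i using exhaust_3[of i]
      by (auto simp: Sol_def intro!: derivative_eq_intros bounded_linear_imp_has_derivative[OF bounded_linear_vec_nth])
    done
  then have "(\<lambda>v. vector [v$1, exp (p$1) * v$2, exp (- (p$1)) * v$3]) = frechet_derivative (\<lambda>q. p \<otimes>\<^bsub>Sol\<^esub> q) (at q)"
    by (rule frechet_derivative_at)
  from fun_cong[OF this, of v] show ?thesis by (rule sym)
qed

lemma left_invariant_field_eq:
  "left_invariant_field v p = vector [v$1, exp (p$1) * v$2, exp (- (p$1)) * v$3]"
  by (simp add: left_invariant_field_def frechet_mult)

lemma left_invariant_field_invariant:
  "frechet_derivative (\<lambda>q. a \<otimes>\<^bsub>Sol\<^esub> q) (at p) (left_invariant_field v p)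
     = left_invariant_field v (a \<otimes>\<^bsub>Sol\<^esub> p)"
  unfolding frechet_mult left_invariant_field_eq
  by (simp add: vec_eq_iff forall_3 Sol_def exp_add exp_minus_add)

lemma frechet_left_invariant_field:
  "frechet_derivative (left_invariant_field v) (at p) w
     = vector [0, exp (p$1) * w$1 * v$2, - (exp (- (p$1)) * w$1 * v$3)]"
proof -
  have "(left_invariant_field v has_derivative
          (\<lambda>w. vector [0, exp (p$1) * w$1 * v$2, - (exp (- (p$1)) * w$1 * v$3)])) (at p)"
  proof (rule has_derivative_vec3)
    fix i :: 3
    note [derivative_intros] = bounded_linear_imp_has_derivative[OF bounded_linear_vec_nth]
    consider "i = 1" | "i = 2" | "i = 3" using exhaust_3[of i] by blast
    then show "((\<lambda>q. left_invariant_field v q $ i) has_derivative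
        (\<lambda>w. vector [0, exp (p$1) * w$1 * v$2, - (exp (- (p$1)) * w$1 * v$3)] $ i)) (at p)"
    proof cases
      case 1 show ?thesis unfolding 1 left_invariant_field_eq vector_3
        by (rule derivative_eq_intros refl)+
    next
      case 2 show ?thesis unfolding 2 left_invariant_field_eq vector_3
        by (rule derivative_eq_intros refl)+ (simp add: fun_eq_iff algebra_simps)
    next
      case 3 show ?thesis unfolding 3 left_invariant_field_eq vector_3
        by (rule derivative_eq_intros refl)+ (simp add: fun_eq_iff algebra_simps)
    qed
  qed
  from fun_cong[OF frechet_derivative_at[OF this], of w] show ?thesis by (rule sym)
qed

lemma bracket_relations:
  "lie_bracket (B0 1) (B0 2) = B0 2"
  "lie_bracket (B0 1) (B0 3) = (\<lambda>p. - B0 3 p)"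
  "lie_bracket (B0 2) (B0 3) = (\<lambda>p. 0)"
  by (simp_all add: fun_eq_iff B0_def lie_bracket_def frechet_left_invariant_field
        left_invariant_field_eq vec_eq_iff forall_3 axis_def)

lemma left_invariant_field_B0: "left_invariant_field v p = (\<Sum>i\<in>UNIV. v$i *\<^sub>R B0 i p)"
  by (simp add: B0_def left_invariant_field_eq vec_eq_iff forall_3 sum_3 axis_def)

lemma B0_one: "B0 i \<one>\<^bsub>Sol\<^esub> = axis i 1"
  by (simp add: B0_def left_invariant_field_eq Sol_def vec_eq_iff forall_3)

text \<open>Affine maps plus the exponential terms occurring in the group operations; this family is
  closed under directional derivatives.\<close>

lemma smooth_family:
  fixes M :: "'a::real_normed_vector \<Rightarrow> real^3" and l m n :: "'a \<Rightarrow> real"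
  assumes M: "bounded_linear M" and l: "bounded_linear l"
    and m: "bounded_linear m" and n: "bounded_linear n"
  shows "k_smooth k (\<lambda>x. A + M x + vector [0, exp (l x) * (b + m x), exp (- l x) * (c + n x)])"
  using M m n
proof (induction k arbitrary: A M b m c n)
  have d: "((\<lambda>x. A + M x + vector [0, exp (l x) * (b + m x), exp (- l x) * (c + n x)]) has_derivative
     (\<lambda>v. M v + 0 + vector [0, exp (l x) * ((l v * b + m v) + l v *\<^sub>R m x),
                               exp (- l x) * ((n v - l v * c) + (- l v) *\<^sub>R n x)])) (at x)"
    if "bounded_linear M" "bounded_linear m" "bounded_linear n"
    for A :: "real^3" and M :: "'a \<Rightarrow> real^3" and b m c n x
  proof (rule has_derivative_vec3)
    fix i :: 3
    note [derivative_intros] = bounded_linear_imp_has_derivative[OF l]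
      bounded_linear_imp_has_derivative[OF that(2)] bounded_linear_imp_has_derivative[OF that(3)]
      bounded_linear_imp_has_derivative[OF bounded_linear_compose[OF bounded_linear_vec_nth that(1)]]
    consider "i = 1" | "i = 2" | "i = 3" using exhaust_3[of i] by blast
    then show "((\<lambda>x. (A + M x + vector [0, exp (l x) * (b + m x), exp (- l x) * (c + n x)]) $ i) has_derivative
     (\<lambda>v. (M v + 0 + vector [0, exp (l x) * ((l v * b + m v) + l v *\<^sub>R m x),
                               exp (- l x) * ((n v - l v * c) + (- l v) *\<^sub>R n x)]) $ i)) (at x)"
    proof cases
      case 1 show ?thesis unfolding 1 vector_add_component vector_3
        by (rule derivative_eq_intros refl)+ simp
    next
      case 2 show ?thesis unfolding 2 vector_add_component vector_3
        by (rule derivative_eq_intros refl)+ (simp add: fun_eq_iff algebra_simps)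
    next
      case 3 show ?thesis unfolding 3 vector_add_component vector_3
        by (rule derivative_eq_intros refl)+ (simp add: fun_eq_iff algebra_simps)
    qed
  qed
  {
    case 0
    show ?case unfolding k_smooth.simps
      using has_derivative_continuous[OF d[OF 0]] by (blast intro: continuous_at_imp_continuous_on)
  next
    case (Suc k)
    have fd: "frechet_derivative (\<lambda>x. A + M x + vector [0, exp (l x) * (b + m x), exp (- l x) * (c + n x)]) (at x)
      = (\<lambda>v. M v + 0 + vector [0, exp (l x) * ((l v * b + m v) + l v *\<^sub>R m x),
                               exp (- l x) * ((n v - l v * c) + (- l v) *\<^sub>R n x)])" for x
      by (rule frechet_derivative_at[OF d[OF Suc.prems], symmetric])
    show ?case
      unfolding k_smooth.simps fd
    proof (intro conjI allI)
      fix x show "(\<lambda>x. A + M x + vector [0, exp (l x) * (b + m x), exp (- l x) * (c + n x)]) differentiable at x"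
        using d[OF Suc.prems] unfolding differentiable_def by blast
    next
      fix v
      show "k_smooth k (\<lambda>x. M v + 0 + vector [0, exp (l x) * ((l v * b + m v) + l v *\<^sub>R m x),
                               exp (- l x) * ((n v - l v * c) + (- l v) *\<^sub>R n x)])"
        by (rule Suc.IH[where M = "\<lambda>x. 0" and m = "\<lambda>x. l v *\<^sub>R m x"
              and n = "\<lambda>x. (- l v) *\<^sub>R n x"])
          (rule bounded_linear_zero bounded_linear_compose[OF bounded_linear_scaleR_right] Suc.prems)+
    qed
  }
qed

lemma smooth_mult_Sol: "smooth (\<lambda>z. fst z \<otimes>\<^bsub>Sol\<^esub> snd z)"
proof -
  have bl: "bounded_linear (\<lambda>z::(real^3) \<times> (real^3). fst z $ i)"
           "bounded_linear (\<lambda>z::(real^3) \<times> (real^3). snd z $ i)" for i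
    by (auto intro!: bounded_linear_compose[OF bounded_linear_vec_nth] bounded_linear_fst bounded_linear_snd)
  have ax: "bounded_linear (\<lambda>z. fst z + axis 1 (snd z $ 1) :: real^3)"
    by (rule linear_conv_bounded_linear[THEN iffD1], rule linearI) (auto simp: vec_eq_iff axis_def algebra_simps)
  have "(\<lambda>z. fst z \<otimes>\<^bsub>Sol\<^esub> snd z) =
    (\<lambda>z. 0 + (fst z + axis 1 (snd z $ 1)) + vector [0, exp (fst z $ 1) * (0 + snd z $ 2), exp (- (fst z $ 1)) * (0 + snd z $ 3)])"
    by (auto simp: fun_eq_iff Sol_def vec_eq_iff forall_3 axis_def)
  then show ?thesis
    unfolding smooth_def using smooth_family[OF ax bl(1)[of 1] bl(2)[of 2] bl(2)[of 3], of _ 0 0 0] by simp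
qed

lemma smooth_inv_Sol: "smooth (\<lambda>p. inv\<^bsub>Sol\<^esub> p)"
proof -
  have bl: "bounded_linear (\<lambda>p::real^3. - (p $ i))" for i
    by (intro bounded_linear_minus bounded_linear_vec_nth)
  have ax: "bounded_linear (\<lambda>p::real^3. axis 1 (- (p $ 1)) :: real^3)"
    by (rule linear_conv_bounded_linear[THEN iffD1], rule linearI) (auto simp: vec_eq_iff axis_def algebra_simps)
  have "(\<lambda>p. inv\<^bsub>Sol\<^esub> p) =
    (\<lambda>p. 0 + axis 1 (- (p $ 1)) + vector [0, exp (- (p $ 1)) * (0 + - (p $ 2)), exp (- (- (p $ 1))) * (0 + - (p $ 3))])"
    by (auto simp: fun_eq_iff inv_Sol vec_eq_iff forall_3 axis_def)
  then show ?thesis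
    unfolding smooth_def using smooth_family[OF ax bl[of 1] bl[of 2] bl[of 3], of _ 0 0 0] by simp
qed

end

theory Submission
  imports Defs
begin

text \<open>
  A left invariant metric is determined by its form \<open>B\<close> at the identity, and the automorphisms of
  \<open>sol\<close> are the maps \<open>X\<^sub>1 \<mapsto> X\<^sub>1 + c X\<^sub>2 + d X\<^sub>3\<close>, \<open>X\<^sub>2 \<mapsto> a X\<^sub>2\<close>, \<open>X\<^sub>3 \<mapsto> b X\<^sub>3\<close> and their
  compositions with the swap \<open>X\<^sub>1 \<mapsto> - X\<^sub>1\<close>, \<open>X\<^sub>2 \<leftrightarrow> X\<^sub>3\<close>.
  If \<open>B\<close> is nondegenerate on the ideal spanned by \<open>X\<^sub>2\<close> and \<open>X\<^sub>3\<close>, then \<open>c\<close> and \<open>d\<close> make \<open>X\<^sub>1\<close>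
  orthogonal to it, and scaling leads to (1)-(4) or (6) according to the signs of the diagonal
  entries on the ideal. Otherwise \<open>B\<close> is positive semidefinite of rank one there, \<open>c\<close> and \<open>d\<close>
  make \<open>X\<^sub>1\<close> null and orthogonal to \<open>X\<^sub>2\<close>, and the result is (5) or (7). The signature enters only
  through two facts: the Gram determinant is negative, and the ideal contains a vector on which
  \<open>B\<close> is positive.
\<close>

section \<open>Normal forms of Gram matrices\<close>

definition sym_matrix3 :: "real \<Rightarrow> real \<Rightarrow> real \<Rightarrow> real \<Rightarrow> real \<Rightarrow> real \<Rightarrow> real^3^3" where
  "sym_matrix3 x y z p r s = matrix3 x y z y p r z r s"

text \<open>For \<open>u < v\<close> the clause \<open>u^2 \<noteq> v^2\<close> only excludes
  \<open>u = - v\<close>, where the forms (1) and (2) would divide by zero.\<close>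

definition normal_form :: "real^3^3 \<Rightarrow> bool" where
  "normal_form M \<longleftrightarrow>
     (\<exists>u v. v > 0 \<and> u < v \<and> u^2 \<noteq> v^2 \<and> M = sym_matrix3 (4 / (u^2 - v^2)) 0 0 1 (u / v) 1)
   \<or> (\<exists>u v. v > 0 \<and> u < v \<and> u^2 \<noteq> v^2 \<and> M = sym_matrix3 (4 / (v^2 - u^2)) 0 0 (u / v) (-1) (u / v))
   \<or> (\<exists>u v. u > 0 \<and> v > 0 \<and> M = sym_matrix3 (1 / (u + v)) 0 0 (- v / u) 1 1)
   \<or> (\<exists>u. u > 0 \<and> M = sym_matrix3 (1 / u) 0 0 (-1) 0 1)
   \<or> (\<exists>b. b > 0 \<and> M = sym_matrix3 0 0 (- 2 / b) 1 1 1)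
   \<or> (\<exists>l. l \<noteq> 0 \<and> M = sym_matrix3 (l^2) 0 0 l 1 0)
   \<or> M = sym_matrix3 0 0 1 1 0 0"

text \<open>Solving \<open>w = u / v\<close> and \<open>\<alpha> = 4 / (u^2 - v^2)\<close> gives
  \<open>v^2 = 4 / (\<alpha> * (w^2 - 1))\<close> and \<open>u = w * v\<close>; then
  \<open>w \<le> 0\<close> ensures \<open>u < v\<close>.\<close>

lemma normal_form_1I:
  assumes "\<alpha> * (w^2 - 1) > 0" "w \<le> 0"
  shows "normal_form (sym_matrix3 \<alpha> 0 0 1 w 1)"
proof -
  define v where "v = 2 / sqrt (\<alpha> * (w^2 - 1))"
  have v: "v > 0" and v2: "v^2 = 4 / (\<alpha> * (w^2 - 1))"
    using assms by (simp_all add: v_def power_divide)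
  have nz: "\<alpha> \<noteq> 0" "w^2 - 1 \<noteq> 0" using assms by auto
  have "(w * v)^2 - v^2 = (w^2 - 1) * v^2" by (simp add: algebra_simps)
  also have "\<dots> = 4 / \<alpha>"
    using nz unfolding v2 times_divide_eq_right by (metis mult.commute mult_divide_mult_cancel_left)
  finally have d: "(w * v)^2 - v^2 = 4 / \<alpha>" .
  have "w * v < v" using v assms(2) by (smt (verit) mult_nonpos_nonneg)
  moreover have "(w * v)^2 \<noteq> v^2" using d nz by auto
  moreover have "4 / ((w * v)^2 - v^2) = \<alpha>" unfolding d using nz by simp
  moreover have "w * v / v = w" using v by simp
  ultimately show ?thesis
    unfolding normal_form_def using v by (intro disjI1 exI[of _ "w * v"] exI[of _ v]) simp
qed

lemma normal_form_2I:
  assumes "\<alpha> * (1 - w^2) > 0" "w \<le> 0"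
  shows "normal_form (sym_matrix3 \<alpha> 0 0 w (-1) w)"
proof -
  define v where "v = 2 / sqrt (\<alpha> * (1 - w^2))"
  have v: "v > 0" and v2: "v^2 = 4 / (\<alpha> * (1 - w^2))"
    using assms by (simp_all add: v_def power_divide)
  have nz: "\<alpha> \<noteq> 0" "1 - w^2 \<noteq> 0" using assms by auto
  have "v^2 - (w * v)^2 = (1 - w^2) * v^2" by (simp add: algebra_simps)
  also have "\<dots> = 4 / \<alpha>"
    using nz unfolding v2 times_divide_eq_right by (metis mult.commute mult_divide_mult_cancel_left)
  finally have d: "v^2 - (w * v)^2 = 4 / \<alpha>" .
  have "w * v < v" using v assms(2) by (smt (verit) mult_nonpos_nonneg)
  moreover have "(w * v)^2 \<noteq> v^2" using d nz by auto
  moreover have "4 / (v^2 - (w * v)^2) = \<alpha>" unfolding d using nz by simp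
  moreover have "w * v / v = w" using v by simp
  ultimately show ?thesis
    unfolding normal_form_def
    by (intro disjI2[OF disjI1] exI[of _ "w * v"] exI[of _ v]) (use v in simp)
qed

text \<open>With \<open>v = w * u\<close> the equation \<open>\<alpha> = 1 / (u + v)\<close> becomes
  linear in \<open>1 / u\<close>.\<close>

lemma normal_form_3I:
  assumes "\<alpha> > 0" "w > 0"
  shows "normal_form (sym_matrix3 \<alpha> 0 0 (- w) 1 1)"
proof -
  define u where "u = 1 / (\<alpha> * (1 + w))"
  have u: "u > 0" using assms by (simp add: u_def)
  have "u + w * u = (1 + w) * u" by (simp add: algebra_simps)
  also have "\<dots> = 1 / \<alpha>" using assms by (simp add: u_def)
  finally have "1 / (u + w * u) = \<alpha>" by simp
  then show ?thesis
    unfolding normal_form_def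
    by (intro disjI2[OF disjI2[OF disjI1]] exI[of _ u] exI[of _ "w * u"]) (use u assms in simp)
qed

lemma normal_form_4I: "\<alpha> > 0 \<Longrightarrow> normal_form (sym_matrix3 \<alpha> 0 0 (-1) 0 1)"
  unfolding normal_form_def
  by (intro disjI2[OF disjI2[OF disjI2[OF disjI1]]] exI[of _ "1 / \<alpha>"]) simp

lemma normal_form_5I: "\<beta> < 0 \<Longrightarrow> normal_form (sym_matrix3 0 0 \<beta> 1 1 1)"
  unfolding normal_form_def
  by (intro disjI2[OF disjI2[OF disjI2[OF disjI2[OF disjI1]]]] exI[of _ "- 2 / \<beta>"])
    (simp add: divide_neg_neg)

lemma normal_form_6I: "l \<noteq> 0 \<Longrightarrow> normal_form (sym_matrix3 (l^2) 0 0 l 1 0)"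
  unfolding normal_form_def by blast

lemma normal_form_7I: "normal_form (sym_matrix3 0 0 1 1 0 0)"
  unfolding normal_form_def by blast

text \<open>The side conditions \<open>order\<close>, here and below, choose an order of \<open>X\<^sub>2\<close> and \<open>X\<^sub>3\<close>;
  the automorphism that swaps the two achieves them.\<close>

lemma nondegenerate_plane_normal_form:
  fixes \<alpha> p r s :: real
  assumes neg: "\<alpha> * (p * s - r^2) < 0"
    and def: "p * s - r^2 > 0 \<Longrightarrow> p > 0"
    and order: "\<not> (p > 0 \<and> s < 0)" "\<not> (p = 0 \<and> s \<noteq> 0)"
  shows "\<exists>a b. a \<noteq> 0 \<and> b \<noteq> 0 \<and>
    normal_form (sym_matrix3 \<alpha> 0 0 (a^2 * p) (a * b * r) (b^2 * s))"
proof -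
  have \<alpha>_pos: "\<alpha> > 0" if "p * s - r^2 < 0"
    using neg that by (simp add: mult_less_0_iff)
  \<comment> \<open>The cases lead to the forms (1), (2), (3) or (4), (6), and (2) with
    \<open>u = 0\<close>, in this order.\<close>
  consider "p > 0" "s > 0" | "p < 0" "s < 0" | "p < 0" "s > 0" | "p \<noteq> 0" "s = 0" | "p = 0" "s = 0"
    using order by linarith
  then show ?thesis
  proof cases
    case 1
    define a where "a = 1 / sqrt p"
    \<comment> \<open>The sign of \<open>b\<close> makes the off-diagonal entry nonpositive, as form
      (1) demands here.\<close>
    define b where "b = (if r > 0 then -1 else 1) / sqrt s"
    have ab: "a^2 * p = 1" "b^2 * s = 1" "a \<noteq> 0" "b \<noteq> 0"
      using 1 by (auto simp: a_def b_def power_divide)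
    have "a * b * r \<le> 0"
      using 1 by (auto simp: a_def b_def divide_simps mult_nonneg_nonpos)
    moreover have "(a * b * r)^2 - 1 = - (a^2 * b^2 * (p * s - r^2))"
      using ab(1,2) by (simp add: power_mult_distrib algebra_simps)
    then have "\<alpha> * ((a * b * r)^2 - 1) = (a^2 * b^2) * (- (\<alpha> * (p * s - r^2)))"
      by algebra
    then have "\<alpha> * ((a * b * r)^2 - 1) > 0"
      using neg ab(3,4) by (simp add: mult_pos_neg)
    ultimately have "normal_form (sym_matrix3 \<alpha> 0 0 1 (a * b * r) 1)"
      by (intro normal_form_1I)
    then show ?thesis using ab by metis
  next
    case 2
    have "p * s - r^2 \<noteq> 0" using neg by auto
    then have D: "p * s - r^2 < 0" using def 2 by force
    have ps: "p * s > 0" using 2 by (simp add: mult_neg_neg)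
    have r: "r \<noteq> 0" using D ps by auto
    \<comment> \<open>Taking \<open>a^2 = - s * k\<close> and \<open>b^2 = - p * k\<close> makes
      both diagonal entries equal to \<open>- p * s * k\<close>. This \<open>k\<close> normalises
      the off-diagonal entry to absolute value 1, and the sign of \<open>b\<close> turns it into
      -1.\<close>
    define k where "k = 1 / (\<bar>r\<bar> * sqrt (p * s))"
    have k: "k > 0" "k * \<bar>r\<bar> * sqrt (p * s) = 1" using ps r by (auto simp: k_def)
    define a where "a = sqrt (- s * k)"
    define b where "b = - sgn r * sqrt (- p * k)"
    have a2: "a^2 = - s * k" and b2: "b^2 = - p * k" and nz: "a \<noteq> 0" "b \<noteq> 0"
      using 2 k r by (auto simp: a_def b_def power_mult_distrib sgn_if mult_neg_pos order_less_imp_le)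
    have "sqrt (- s * k) * sqrt (- p * k) = sqrt ((p * s) * k^2)"
      unfolding real_sqrt_mult[symmetric] by (simp add: power2_eq_square algebra_simps)
    also have "\<dots> = sqrt (p * s) * k" using k by (simp add: real_sqrt_mult)
    finally have "a * b * r = - (sqrt (p * s) * k * (sgn r * r))"
      by (simp add: a_def b_def)
    then have abr: "a * b * r = -1"
      using k by (simp add: abs_sgn mult.commute mult.left_commute)
    define w where "w = a^2 * p"
    have w: "w = b^2 * s" "w \<le> 0"
      using 2 by (simp add: w_def a2 b2, simp add: w_def mult_nonneg_nonpos)
    have "w^2 = (a^2 * p) * (b^2 * s)" using w by (simp add: power2_eq_square w_def)
    moreover have "(a * b * r)^2 = 1" using abr by simp
    ultimately have "1 - w^2 = - (a^2 * b^2 * (p * s - r^2))"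
      by (simp add: power_mult_distrib algebra_simps)
    then have "\<alpha> * (1 - w^2) = (a^2 * b^2) * (- (\<alpha> * (p * s - r^2)))"
      by algebra
    then have "\<alpha> * (1 - w^2) > 0" using neg nz by (simp add: mult_pos_neg)
    from normal_form_2I[OF this w(2)] show ?thesis using nz abr w(1) w_def by metis
  next
    case 3
    then have "p * s < 0" by (simp add: mult_neg_pos)
    then have \<alpha>: "\<alpha> > 0" using \<alpha>_pos zero_le_power2[of r] by linarith
    define b where "b = 1 / sqrt s"
    have b: "b^2 * s = 1" "b \<noteq> 0" using 3 by (auto simp: b_def power_divide)
    show ?thesis
    proof (cases "r = 0")
      case True
      define a where "a = 1 / sqrt (- p)"
      have "a^2 * p = -1" "a \<noteq> 0" using 3 by (auto simp: a_def power_divide)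
      with b True normal_form_4I[OF \<alpha>] show ?thesis by (metis mult_zero_right)
    next
      case False
      define a where "a = 1 / (b * r)"
      have a: "a * b * r = 1" "a \<noteq> 0" using False b by (auto simp: a_def)
      then have "- (a^2 * p) > 0" using 3 by (simp add: mult_pos_neg)
      from normal_form_3I[OF \<alpha> this] a b show ?thesis by (metis minus_minus)
    qed
  next
    case 4
    then have r: "r \<noteq> 0" using neg by auto
    then have \<alpha>: "\<alpha> > 0" using \<alpha>_pos 4 by simp
    \<comment> \<open>Of the two roots of \<open>l^2 = \<alpha>\<close>, the one with the sign of
      \<open>p\<close> is chosen, so that \<open>l / p\<close> is a square
      \<open>a^2\<close>.\<close>
    define l where "l = sgn p * sqrt \<alpha>"
    have l: "l \<noteq> 0" "l^2 = \<alpha>" "l / p > 0"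
      using \<alpha> 4 by (auto simp: l_def power_mult_distrib sgn_if divide_pos_neg)
    define a where "a = sqrt (l / p)"
    have a: "a^2 * p = l" "a \<noteq> 0" using l 4 by (auto simp: a_def)
    define b where "b = 1 / (a * r)"
    have "a * b * r = 1" "b \<noteq> 0" using a r by (auto simp: b_def)
    with a 4 l normal_form_6I[OF l(1)] show ?thesis by (metis mult_zero_right)
  next
    case 5
    then have r: "r \<noteq> 0" using neg by auto
    then have "\<alpha> > 0" using \<alpha>_pos 5 by simp
    then have "normal_form (sym_matrix3 \<alpha> 0 0 0 (-1) 0)" by (intro normal_form_2I) simp_all
    with 5 r show ?thesis by (intro exI[of _ 1] exI[of _ "- 1 / r"]) simp
  qed
qed

text \<open>The entries in the conclusion are those of the Gram matrix after
  \<open>X\<^sub>1\<close> becomes \<open>X\<^sub>1 + c X\<^sub>2 + d X\<^sub>3\<close> and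
  \<open>X\<^sub>2\<close>, \<open>X\<^sub>3\<close> are scaled by \<open>a\<close>,
  \<open>b\<close>. The numbers \<open>m\<close>, \<open>n\<close> are the coordinates of a positive
  vector in the ideal.\<close>

lemma normal_form_exists:
  fixes x y z p r s :: real
  assumes det: "x * (p * s - r^2) - y * (y * s - r * z) + z * (y * r - p * z) < 0"
    and pos: "p * m^2 + 2 * r * m * n + s * n^2 > 0"
    and order: "\<not> (p > 0 \<and> s < 0)" "\<not> (p = 0 \<and> s \<noteq> 0)"
  shows "\<exists>a b c d. a \<noteq> 0 \<and> b \<noteq> 0 \<and>
    normal_form (sym_matrix3 (x + 2 * c * y + 2 * d * z + c^2 * p + 2 * c * d * r + d^2 * s)
      (a * (y + c * p + d * r)) (b * (z + c * r + d * s)) (a^2 * p) (a * b * r) (b^2 * s))"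
proof (cases "p * s - r^2 = 0")
  case False
  define D where "D = p * s - r^2"
  \<comment> \<open>Cramer's rule for the two equations that make the new first vector orthogonal to
    the ideal.\<close>
  define c where "c = (r * z - s * y) / D"
  define d where "d = (r * y - p * z) / D"
  define \<alpha> where "\<alpha> = x + c * y + d * z"
  have D: "D \<noteq> 0" using False by (simp add: D_def)
  have cD: "c * D = r * z - s * y" and dD: "d * D = r * y - p * z" using D by (simp_all add: c_def d_def)
  have "(y + c * p + d * r) * D = y * D + p * (c * D) + r * (d * D)" by algebra
  also have "\<dots> = 0" unfolding cD dD unfolding D_def by algebra
  finally have y': "y + c * p + d * r = 0" using D by simp
  have "(z + c * r + d * s) * D = z * D + r * (c * D) + s * (d * D)" by algebra
  also have "\<dots> = 0" unfolding cD dD unfolding D_def by algebra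
  finally have z': "z + c * r + d * s = 0" using D by simp
  have x': "x + 2 * c * y + 2 * d * z + c^2 * p + 2 * c * d * r + d^2 * s = \<alpha>"
    unfolding \<alpha>_def using y' z' by algebra
  \<comment> \<open>Adding multiples of the other basis vectors preserves the Gram determinant,
    which is now \<open>\<alpha> * D\<close>.\<close>
  have "\<alpha> * D = x * D + y * (c * D) + z * (d * D)" unfolding \<alpha>_def by algebra
  then have neg: "\<alpha> * (p * s - r^2) < 0"
    using det unfolding cD dD unfolding D_def by (simp add: algebra_simps)
  \<comment> \<open>A plane form of positive determinant is definite, as completing the square
    shows; the positive vector fixes the sign.\<close>
  have "p > 0" if "p * s - r^2 > 0"
  proof (rule ccontr)
    assume "\<not> p > 0"
    then have "p * (p * m^2 + 2 * r * m * n + s * n^2) \<le> 0"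
      using pos by (intro mult_nonpos_nonneg) auto
    moreover have "p * (p * m^2 + 2 * r * m * n + s * n^2) = (p * m + r * n)^2 + (p * s - r^2) * n^2"
      by algebra
    moreover have "(p * s - r^2) * n^2 \<ge> 0" using that by simp
    ultimately have "(p * m + r * n)^2 = 0" "(p * s - r^2) * n^2 = 0"
      using zero_le_power2[of "p * m + r * n"] by linarith+
    then have "n = 0" "p * m = 0" using that by auto
    then show False using pos \<open>\<not> p > 0\<close> by auto
  qed
  from nondegenerate_plane_normal_form[OF neg this order]
  obtain a b where "a \<noteq> 0" "b \<noteq> 0"
    "normal_form (sym_matrix3 \<alpha> 0 0 (a^2 * p) (a * b * r) (b^2 * s))" by blast
  then show ?thesis
    by (intro exI[of _ a] exI[of _ b] exI[of _ c] exI[of _ d]) (simp add: x' y' z')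
next
  case True
  then have rr: "r^2 = p * s" by simp
  have "p * (p * m^2 + 2 * r * m * n + s * n^2) = (p * m + r * n)^2"
    using rr by algebra
  then have "p * (p * m^2 + 2 * r * m * n + s * n^2) \<ge> 0" by simp
  then have "p \<ge> 0" using pos by (simp add: zero_le_mult_iff)
  \<comment> \<open>If \<open>p = 0\<close>, then \<open>order\<close> gives \<open>s = 0\<close>,
    hence \<open>r = 0\<close>, and the Gram determinant would vanish.\<close>
  moreover have "p \<noteq> 0" using det rr order(2) by auto
  ultimately have p: "p > 0" by simp
  then have s: "s \<ge> 0" using order(1) by simp
  \<comment> \<open>This is the entry (1, 3) once the entry (1, 2) is zero; \<open>d\<close> cancels
    from it because \<open>r^2 = p * s\<close>.\<close>
  define \<zeta> where "\<zeta> = z - y * r / p"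
  have yr: "p * \<zeta> = p * z - y * r" using p by (simp add: \<zeta>_def field_simps)
  have "p * (x * (p * s - r^2) - y * (y * s - r * z) + z * (y * r - p * z)) = - ((p * \<zeta>)^2)"
    unfolding yr using rr by algebra
  then have \<zeta>: "\<zeta> \<noteq> 0" using det p by auto
  \<comment> \<open>With \<open>c\<close> chosen to kill the entry \<open>(1, 2)\<close>, the entry \<open>(1, 1)\<close> is \<open>x - y^2 / p + 2 * d * \<zeta>\<close>.\<close>
  define d where "d = - (x - y^2 / p) / (2 * \<zeta>)"
  define c where "c = - (y + d * r) / p"
  have cp: "c * p = - (y + d * r)" using p by (simp add: c_def)
  have y': "y + c * p + d * r = 0" using cp by simp
  have "p * (z + c * r + d * s) = p * z + r * (c * p) + d * (p * s)" by algebra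
  also have "\<dots> = p * \<zeta>" unfolding cp yr using rr by algebra
  finally have z': "z + c * r + d * s = \<zeta>" using p by simp
  have d\<zeta>: "2 * d * \<zeta> = - (x - y^2 / p)" using \<zeta> by (simp add: d_def)
  then have "p * (2 * d * \<zeta>) = y^2 - p * x" using p by (simp add: field_simps)
  moreover have "x + 2 * c * y + 2 * d * z + c^2 * p + 2 * c * d * r + d^2 * s = x + c * y + d * z + d * \<zeta>"
    using y' z' by algebra
  then have "p * (x + 2 * c * y + 2 * d * z + c^2 * p + 2 * c * d * r + d^2 * s)
    = p * x + y * (c * p) + d * (p * z) + d * (p * \<zeta>)" by algebra
  ultimately have "p * (x + 2 * c * y + 2 * d * z + c^2 * p + 2 * c * d * r + d^2 * s) = 0"
    unfolding cp using yr by algebra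
  then have x': "x + 2 * c * y + 2 * d * z + c^2 * p + 2 * c * d * r + d^2 * s = 0" using p by simp
  have "\<exists>a b. a \<noteq> 0 \<and> b \<noteq> 0 \<and> normal_form (sym_matrix3 0 0 (b * \<zeta>) (a^2 * p) (a * b * r) (b^2 * s))"
  proof (cases "s = 0")
    case True
    then have "r = 0" using rr by simp
    then show ?thesis using True p \<zeta> normal_form_7I
      by (intro exI[of _ "1 / sqrt p"] exI[of _ "1 / \<zeta>"]) (simp add: power_divide)
  next
    case False
    then have s: "s > 0" and r: "r \<noteq> 0" using s rr p by auto
    define b where "b = - sgn \<zeta> / sqrt s"
    have b: "b^2 * s = 1" "b \<noteq> 0" "b * \<zeta> < 0"
      using s \<zeta> by (auto simp: b_def power_divide sgn_if divide_neg_pos)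
    \<comment> \<open>Rank one gives \<open>(a * b * r)^2 = (a^2 * p) * (b^2 * s)\<close>, so
      normalising two entries of the block normalises the third.\<close>
    define a where "a = 1 / (b * r)"
    have a: "a * b * r = 1" "a \<noteq> 0" using b r by (auto simp: a_def)
    have "(a * b * r)^2 = (a^2 * p) * (b^2 * s)" using rr by algebra
    then have "a^2 * p = 1" using a b by simp
    then show ?thesis using a b normal_form_5I[OF b(3)] by metis
  qed
  then obtain a b where "a \<noteq> 0" "b \<noteq> 0"
    "normal_form (sym_matrix3 0 0 (b * \<zeta>) (a^2 * p) (a * b * r) (b^2 * s))" by blast
  then show ?thesis
    by (intro exI[of _ a] exI[of _ b] exI[of _ c] exI[of _ d]) (simp add: x' y' z')
qed

section \<open>Left invariant metrics and their forms at the identity\<close>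

text \<open>This is the differential at \<open>p\<close> of left translation by the group inverse of
  \<open>p\<close>.\<close>

definition to_identity :: "real^3 \<Rightarrow> real^3 \<Rightarrow> real^3" where
  "to_identity p v = vector [v$1, exp (- (p$1)) * v$2, exp (p$1) * v$3]"

definition left_metric :: "(real^3 \<Rightarrow> real^3 \<Rightarrow> real) \<Rightarrow> metric" where
  "left_metric B = (\<lambda>p v w. B (to_identity p v) (to_identity p w))"

definition gram :: "(real^3 \<Rightarrow> real^3 \<Rightarrow> real) \<Rightarrow> real^3^3" where
  "gram B = (\<chi> i j. B (axis i 1) (axis j 1))"

lemma to_identity_one [simp]: "to_identity 0 v = v"
  by (simp add: to_identity_def vec_eq_iff forall_3)

lemma linear_to_identity: "linear (to_identity p)"
  by (rule linearI) (simp_all add: to_identity_def vec_eq_iff forall_3 algebra_simps)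

text \<open>Here \<open>- p\<close> is negation in the chart. It shares with the group inverse the
  first coordinate, the only one that \<open>to_identity\<close> reads.\<close>

lemma to_identity_inverse:
  "to_identity p (to_identity (- p) v) = v" "to_identity (- p) (to_identity p v) = v"
  by (simp_all add: to_identity_def vec_eq_iff forall_3 flip: mult.assoc exp_add)

lemma left_invariant_eq_left_metric:
  assumes "left_invariant h"
  shows "h = left_metric (h 0)"
proof (intro ext)
  fix p v w
  have "pullback (\<lambda>q. p \<otimes>\<^bsub>Sol\<^esub> q) h 0 (to_identity p v) (to_identity p w)
      = h 0 (to_identity p v) (to_identity p w)"
    using assms by (simp add: left_invariant_def)
  moreover have "p \<otimes>\<^bsub>Sol\<^esub> 0 = p"
    by (simp add: Sol_def vec_eq_iff forall_3)
  moreover have "frechet_derivative (\<lambda>q. p \<otimes>\<^bsub>Sol\<^esub> q) (at 0) (to_identity p v) = v" for v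
    unfolding frechet_mult
    by (simp add: to_identity_def vec_eq_iff forall_3 flip: mult.assoc exp_add)
  ultimately show "h p v w = left_metric (h 0) p v w"
    by (simp add: pullback_def left_metric_def)
qed

lemma left_invariant_left_metric: "left_invariant (left_metric B)"
proof -
  have "to_identity (a \<otimes>\<^bsub>Sol\<^esub> p) (frechet_derivative (\<lambda>q. a \<otimes>\<^bsub>Sol\<^esub> q) (at p) v) = to_identity p v"
    for a p v
    unfolding frechet_mult
    by (simp add: to_identity_def Sol_def vec_eq_iff forall_3 flip: mult.assoc exp_add)
  then show ?thesis
    by (simp add: left_invariant_def pullback_def left_metric_def)
qed

lemma metric_matrix_left_metric: "metric_matrix (left_metric B) = gram B"
  by (simp add: metric_matrix_def B0_one) (simp add: Sol_def left_metric_def gram_def)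

text \<open>A directional derivative only changes the coefficients of such a sum, hence the
  induction over arbitrary \<open>c\<close>. Coefficients of left invariant metrics have this
  shape.\<close>

lemma k_smooth_exp_sum:
  fixes g :: "'i \<Rightarrow> 'a::real_normed_vector \<Rightarrow> real"
  assumes "finite I" and g: "\<And>i. i \<in> I \<Longrightarrow> bounded_linear (g i)"
  shows "k_smooth k (\<lambda>x. \<Sum>i\<in>I. c i * exp (g i x))"
proof (induction k arbitrary: c)
  have d: "((\<lambda>x. \<Sum>i\<in>I. c i * exp (g i x)) has_derivative (\<lambda>v. \<Sum>i\<in>I. (c i * g i v) * exp (g i x))) (at x)"
    for c x
  proof (rule has_derivative_sum)
    fix i assume "i \<in> I"
    note [derivative_intros] = bounded_linear_imp_has_derivative[OF g[OF this]]
    show "((\<lambda>x. c i * exp (g i x)) has_derivative (\<lambda>v. (c i * g i v) * exp (g i x))) (at x)"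
      by (rule derivative_eq_intros refl)+ (simp add: fun_eq_iff)
  qed
  {
    case 0
    show ?case unfolding k_smooth.simps
      using has_derivative_continuous[OF d] by (blast intro: continuous_at_imp_continuous_on)
  next
    case (Suc k)
    show ?case
      unfolding k_smooth.simps frechet_derivative_at[OF d, symmetric]
      by (intro conjI allI differentiableI[OF d] Suc.IH)
  }
qed

lemma smooth_left_metric:
  assumes "bilinear B"
  shows "smooth (\<lambda>p. left_metric B p v w)"
proof -
  \<comment> \<open>\<open>to_identity p\<close> is diagonal and scales the basis vector
    \<open>i\<close> by \<open>exp (k i * p$1)\<close>.\<close>
  define k :: "3 \<Rightarrow> real" where "k i = (if i = 1 then 0 else if i = 2 then -1 else 1)" for i
  have T: "to_identity p v = (\<Sum>i\<in>UNIV. (v$i * exp (k i * p$1)) *\<^sub>R axis i 1)" for p v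
    by (simp add: to_identity_def k_def vec_eq_iff forall_3 sum_3 axis_def)
  have "left_metric B p v w
      = (\<Sum>z\<in>UNIV. (v$fst z * w$snd z * B (axis (fst z) 1) (axis (snd z) 1)) * exp ((k (fst z) + k (snd z)) * p$1))"
    for p
    unfolding left_metric_def T bilinear_sum[OF assms] UNIV_Times_UNIV
    by (intro sum.cong refl)
      (auto simp: bilinear_lmul[OF assms] bilinear_rmul[OF assms] distrib_right exp_add)
  moreover have "bounded_linear (\<lambda>p::real^3. r * p$1)" for r
    by (intro bounded_linear_const_mult bounded_linear_vec_nth)
  ultimately show ?thesis
    unfolding smooth_def by (simp add: k_smooth_exp_sum)
qed

section \<open>Lorentzian signature under linear changes of variable\<close>

lemma lorentzian_form_compose:
  assumes B: "lorentzian_form B" and F: "linear F" "bij F"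
  shows "lorentzian_form (\<lambda>v w. B (F v) (F w))"
proof -
  \<comment> \<open>The inverse of \<open>F\<close> carries an orthogonal basis for \<open>B\<close>
    to one for the composed form, with the same signs.\<close>
  define G where "G = inv_into UNIV F"
  have FG: "F (G v) = v" and GF: "G (F v) = v" for v
    using F by (simp_all add: G_def bij_def surj_f_inv_f)
  have G: "linear G"
    by (rule linearI; rule injD[OF bij_is_inj[OF F(2)]]) (simp_all add: FG linear_add[OF F(1)] linear_scale[OF F(1)])
  obtain e1 e2 e3 where e: "span {e1, e2, e3} = UNIV"
    "B e1 e2 = 0" "B e1 e3 = 0" "B e2 e3 = 0" "B e1 e1 > 0" "B e2 e2 > 0" "B e3 e3 < 0"
    using B unfolding lorentzian_form_def by blast
  have "span {G e1, G e2, G e3} = G ` span {e1, e2, e3}"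
    by (simp add: linear_span_image[OF G, symmetric])
  also have "\<dots> = UNIV"
    unfolding e using GF by (metis surjI)
  finally have "span {G e1, G e2, G e3} = UNIV" .
  moreover have "bilinear (\<lambda>v w. B (F v) (F w))"
    using B F(1) unfolding lorentzian_form_def bilinear_def
    by (auto intro: linear_compose[of F, unfolded comp_def])
  ultimately show ?thesis
    using B e unfolding lorentzian_form_def
    by (intro conjI exI[of _ "G e1"] exI[of _ "G e2"] exI[of _ "G e3"]) (simp_all add: FG)
qed

lemma lorentzian_metric_left_metric:
  assumes "lorentzian_form B"
  shows "lorentzian_metric (left_metric B)"
proof -
  have "bij (to_identity p)" for p
    by (rule bijI') (metis to_identity_inverse)+
  then show ?thesis
    using lorentzian_form_compose[OF assms linear_to_identity] assms
    by (simp add: lorentzian_metric_def smooth_left_metric lorentzian_form_def)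
      (simp add: left_metric_def)
qed

section \<open>Automorphisms\<close>

definition sol_linear :: "real \<Rightarrow> real \<Rightarrow> real \<Rightarrow> real \<Rightarrow> real^3 \<Rightarrow> real^3" where
  "sol_linear a b c d v = vector [v$1, c * v$1 + a * v$2, d * v$1 + b * v$3]"

text \<open>\<open>sol_map a b c d\<close> is the automorphism of the group with differential \<open>sol_linear a b c d\<close>
  at the identity: the one-parameter group of \<open>X\<^sub>1 + c X\<^sub>2 + d X\<^sub>3\<close> is
  \<open>t \<mapsto> (t, c (exp t - 1), d (1 - exp (- t)))\<close>.\<close>

definition sol_map :: "real \<Rightarrow> real \<Rightarrow> real \<Rightarrow> real \<Rightarrow> real^3 \<Rightarrow> real^3" where
  "sol_map a b c d p =
     vector [p$1, a * p$2 + c * (exp (p$1) - 1), b * p$3 + d * (1 - exp (- (p$1)))]"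

text \<open>Being linear, this map serves both as a group automorphism and as its own
  differential.\<close>

definition sol_swap :: "real^3 \<Rightarrow> real^3" where
  "sol_swap p = vector [- (p$1), p$3, p$2]"

lemma linear_sol_linear: "linear (sol_linear a b c d)"
  by (rule linearI) (simp_all add: sol_linear_def vec_eq_iff forall_3 algebra_simps)

lemma linear_sol_swap: "linear sol_swap"
  by (rule linearI) (simp_all add: sol_swap_def vec_eq_iff forall_3)

lemma sol_swap_swap [simp]: "sol_swap (sol_swap p) = p"
  by (simp add: sol_swap_def vec_eq_iff forall_3)

lemma bij_sol_swap: "bij sol_swap"
  by (rule bijI') (metis sol_swap_swap)+

lemma sol_linear_inverse:
  assumes "a \<noteq> 0" "b \<noteq> 0"
  shows "sol_linear a b c d (sol_linear (1/a) (1/b) (-c/a) (-d/b) v) = v"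
    and "sol_linear (1/a) (1/b) (-c/a) (-d/b) (sol_linear a b c d v) = v"
  using assms by (simp_all add: sol_linear_def vec_eq_iff forall_3 field_simps)

lemma sol_map_inverse:
  assumes "a \<noteq> 0" "b \<noteq> 0"
  shows "sol_map a b c d (sol_map (1/a) (1/b) (-c/a) (-d/b) p) = p"
    and "sol_map (1/a) (1/b) (-c/a) (-d/b) (sol_map a b c d p) = p"
  using assms by (simp_all add: sol_map_def vec_eq_iff forall_3 field_simps)

lemma smooth_sol_map: "smooth (sol_map a b c d)"
proof -
  have M: "bounded_linear (\<lambda>p::real^3. vector [p$1, a * p$2, b * p$3] :: real^3)"
    by (rule linear_conv_bounded_linear[THEN iffD1], rule linearI)
      (auto simp: vec_eq_iff forall_3 algebra_simps)
  have "sol_map a b c d = (\<lambda>p. vector [0, - c, d] + vector [p$1, a * p$2, b * p$3]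
      + vector [0, exp (p$1) * (c + 0), exp (- (p$1)) * (- d + 0)])"
    by (auto simp: fun_eq_iff sol_map_def vec_eq_iff forall_3 algebra_simps)
  then show ?thesis
    unfolding smooth_def
    using smooth_family[OF M bounded_linear_vec_nth bounded_linear_zero bounded_linear_zero,
        of _ "vector [0, - c, d]" 1 c "- d"] by simp
qed

lemma sol_map_has_derivative:
  "(sol_map a b c d has_derivative
     (\<lambda>v. vector [v$1, a * v$2 + c * exp (p$1) * v$1, b * v$3 + d * exp (- (p$1)) * v$1])) (at p)"
proof (rule has_derivative_vec3)
  fix i :: 3
  note [derivative_intros] = bounded_linear_imp_has_derivative[OF bounded_linear_vec_nth]
  consider "i = 1" | "i = 2" | "i = 3" using exhaust_3[of i] by blast
  then show "((\<lambda>p. sol_map a b c d p $ i) has_derivative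
    (\<lambda>v. vector [v$1, a * v$2 + c * exp (p$1) * v$1, b * v$3 + d * exp (- (p$1)) * v$1] $ i)) (at p)"
    unfolding sol_map_def
    by cases (auto intro!: derivative_eq_intros simp: algebra_simps)
qed

lemma lie_automorphismI:
  assumes hom: "\<And>p q. \<phi> (p \<otimes>\<^bsub>Sol\<^esub> q) = \<phi> p \<otimes>\<^bsub>Sol\<^esub> \<phi> q"
    and inv: "\<And>p. \<phi> (\<psi> p) = p" "\<And>p. \<psi> (\<phi> p) = p"
    and smooth: "smooth \<phi>" "smooth \<psi>"
  shows "lie_automorphism \<phi>"
proof -
  have "bij \<phi>" by (rule bijI') (metis inv)+
  then have "\<phi> \<in> iso Sol Sol"
    using hom by (simp add: iso_def hom_def) (simp add: Sol_def)
  moreover have "inv_into UNIV \<phi> = \<psi>" by (rule inv_equality) (simp_all add: inv)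
  ultimately show ?thesis using smooth by (simp add: lie_automorphism_def)
qed

lemma lie_automorphism_sol_map:
  assumes "a \<noteq> 0" "b \<noteq> 0"
  shows "lie_automorphism (sol_map a b c d)"
  by (rule lie_automorphismI[OF _ sol_map_inverse[OF assms] smooth_sol_map smooth_sol_map])
    (simp add: sol_map_def Sol_def vec_eq_iff forall_3 algebra_simps exp_add exp_minus_add)

text \<open>A homomorphism commutes with left translations, so after translation to the identity its
  differential is the same linear map at every point.\<close>

lemma pullback_sol_map:
  "pullback (sol_map a b c d) (left_metric B)
     = left_metric (\<lambda>v w. B (sol_linear a b c d v) (sol_linear a b c d w))"
proof -
  have "to_identity (sol_map a b c d p) (frechet_derivative (sol_map a b c d) (at p) v)
      = sol_linear a b c d (to_identity p v)" for p v
    unfolding frechet_derivative_at[OF sol_map_has_derivative, symmetric]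
    by (simp add: to_identity_def sol_map_def sol_linear_def vec_eq_iff forall_3 algebra_simps flip: exp_add)
  then show ?thesis by (simp add: pullback_def left_metric_def)
qed

section \<open>Smoothness under composition with linear maps, and the swap\<close>

lemma smooth_differentiable: "smooth f \<Longrightarrow> f differentiable (at x)"
  unfolding smooth_def by (metis k_smooth.simps(2))

lemma frechet_derivative_compose_linear:
  assumes "bounded_linear L" "f differentiable (at (L x))"
  shows "((\<lambda>x. f (L x)) has_derivative (\<lambda>v. frechet_derivative f (at (L x)) (L v))) (at x)"
  using diff_chain_at[OF bounded_linear_imp_has_derivative[OF assms(1)]
      assms(2)[unfolded frechet_derivative_works]]
  by (simp add: comp_def)

text \<open>The derivative of the composite along \<open>v\<close> is the derivative of
  \<open>f\<close> along \<open>L v\<close>, again composed with \<open>L\<close>; so the induction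
  runs over all \<open>f\<close>.\<close>

lemma k_smooth_compose_linear:
  fixes L :: "'a::real_normed_vector \<Rightarrow> 'b::real_normed_vector"
    and f :: "'b \<Rightarrow> 'c::real_normed_vector"
  assumes L: "bounded_linear L"
  shows "k_smooth k f \<Longrightarrow> k_smooth k (\<lambda>x. f (L x))"
proof (induction k arbitrary: f)
  case 0
  then show ?case
    using continuous_on_compose2[OF _ linear_continuous_on[OF L]] by auto
next
  case (Suc k)
  then have d: "((\<lambda>x. f (L x)) has_derivative (\<lambda>v. frechet_derivative f (at (L x)) (L v))) (at x)" for x
    by (intro frechet_derivative_compose_linear L) simp
  have "k_smooth k (\<lambda>x. frechet_derivative f (at (L x)) (L v))" for v
    by (rule Suc.IH) (use Suc.prems in simp)
  then show ?case
    using d unfolding k_smooth.simps frechet_derivative_at[OF d, symmetric] differentiable_def by blast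
qed

lemma k_smooth_linear_compose:
  fixes L :: "'b::real_normed_vector \<Rightarrow> 'c::real_normed_vector"
    and f :: "'a::real_normed_vector \<Rightarrow> 'b"
  assumes L: "bounded_linear L"
  shows "k_smooth k f \<Longrightarrow> k_smooth k (\<lambda>x. L (f x))"
proof (induction k arbitrary: f)
  case 0
  then show ?case
    using bounded_linear.continuous_on[OF L] by auto
next
  case (Suc k)
  then have d: "((\<lambda>x. L (f x)) has_derivative (\<lambda>v. L (frechet_derivative f (at x) v))) (at x)" for x
    by (intro bounded_linear.has_derivative[OF L]) (simp flip: frechet_derivative_works)
  have "k_smooth k (\<lambda>x. L (frechet_derivative f (at x) v))" for v
    by (rule Suc.IH) (use Suc.prems in simp)
  then show ?case
    using d unfolding k_smooth.simps frechet_derivative_at[OF d, symmetric] differentiable_def by blast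
qed

lemma bounded_linear_sol_swap: "bounded_linear sol_swap"
  using linear_sol_swap linear_conv_bounded_linear by blast

lemma lie_automorphism_compose_swap:
  assumes "lie_automorphism \<phi>"
  shows "lie_automorphism (\<lambda>p. \<phi> (sol_swap p))"
proof (rule lie_automorphismI)
  have carrier: "carrier Sol = UNIV" by (simp add: Sol_def)
  have "\<phi> \<in> hom Sol Sol" and "bij \<phi>"
    using assms by (auto simp: lie_automorphism_def iso_def carrier)
  then have "\<phi> (p \<otimes>\<^bsub>Sol\<^esub> q) = \<phi> p \<otimes>\<^bsub>Sol\<^esub> \<phi> q" for p q
    by (simp add: hom_def carrier)
  moreover have "sol_swap (p \<otimes>\<^bsub>Sol\<^esub> q) = sol_swap p \<otimes>\<^bsub>Sol\<^esub> sol_swap q" for p q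
    by (simp add: sol_swap_def Sol_def vec_eq_iff forall_3)
  ultimately show "\<phi> (sol_swap (p \<otimes>\<^bsub>Sol\<^esub> q)) = \<phi> (sol_swap p) \<otimes>\<^bsub>Sol\<^esub> \<phi> (sol_swap q)" for p q
    by simp
  show "\<phi> (sol_swap (sol_swap (inv_into UNIV \<phi> p))) = p" "sol_swap (inv_into UNIV \<phi> (\<phi> (sol_swap p))) = p" for p
    using \<open>bij \<phi>\<close> by (simp_all add: bij_is_surj surj_f_inv_f bij_is_inj)
  show "smooth (\<lambda>p. \<phi> (sol_swap p))" "smooth (\<lambda>p. sol_swap (inv_into UNIV \<phi> p))"
    using assms bounded_linear_sol_swap unfolding lie_automorphism_def smooth_def
    by (auto intro: k_smooth_compose_linear k_smooth_linear_compose)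
qed

lemma pullback_compose_swap:
  assumes "smooth \<phi>" "pullback \<phi> h = left_metric B"
  shows "pullback (\<lambda>p. \<phi> (sol_swap p)) h = left_metric (\<lambda>v w. B (sol_swap v) (sol_swap w))"
proof -
  have "frechet_derivative (\<lambda>p. \<phi> (sol_swap p)) (at p)
      = (\<lambda>v. frechet_derivative \<phi> (at (sol_swap p)) (sol_swap v))" for p
    using frechet_derivative_compose_linear[OF bounded_linear_sol_swap smooth_differentiable[OF assms(1)]]
    by (metis frechet_derivative_at)
  then have "pullback (\<lambda>p. \<phi> (sol_swap p)) h p v w
      = left_metric B (sol_swap p) (sol_swap v) (sol_swap w)" for p v w
    unfolding assms(2)[symmetric] by (simp add: pullback_def)
  moreover have "to_identity (sol_swap p) (sol_swap v) = sol_swap (to_identity p v)" for p v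
    by (simp add: to_identity_def sol_swap_def vec_eq_iff forall_3)
  ultimately show ?thesis
    by (simp add: fun_eq_iff left_metric_def)
qed

section \<open>Isometries induced by the automorphisms\<close>

lemma isometric_sol_linear:
  assumes "a \<noteq> 0" "b \<noteq> 0"
  shows "isometric_via_automorphism (left_metric B)
    (left_metric (\<lambda>v w. B (sol_linear a b c d v) (sol_linear a b c d w)))"
proof -
  \<comment> \<open>The inverse of \<open>sol_map a b c d\<close> is used, since the original metric
    has to be the pullback of the transformed one.\<close>
  have "lie_automorphism (sol_map (1/a) (1/b) (-c/a) (-d/b))"
    using assms by (intro lie_automorphism_sol_map) auto
  then show ?thesis
    unfolding isometric_via_automorphism_def
    by (intro exI conjI) (assumption, simp only: pullback_sol_map sol_linear_inverse[OF assms])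
qed

lemma isometric_swap:
  assumes "isometric_via_automorphism (left_metric (\<lambda>v w. B (sol_swap v) (sol_swap w))) h"
  shows "isometric_via_automorphism (left_metric B) h"
proof -
  obtain \<phi> where \<phi>: "lie_automorphism \<phi>"
    "pullback \<phi> h = left_metric (\<lambda>v w. B (sol_swap v) (sol_swap w))"
    using assms unfolding isometric_via_automorphism_def by metis
  have "smooth \<phi>" using \<phi>(1) by (simp add: lie_automorphism_def)
  from pullback_compose_swap[OF this \<phi>(2)] lie_automorphism_compose_swap[OF \<phi>(1)]
  show ?thesis
    unfolding isometric_via_automorphism_def
    by (intro exI[of _ "\<lambda>p. \<phi> (sol_swap p)"]) simp
qed

section \<open>Reduction to normal form\<close>

text \<open>Changing to an orthogonal basis multiplies the determinant by the square
  \<open>det E ^ 2\<close> and yields a diagonal matrix with signs (+,+,-).\<close>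

lemma lorentzian_gram_det_neg:
  assumes "lorentzian_form B"
  shows "det (gram B) < 0"
proof -
  have B: "bilinear B" "\<And>v w. B v w = B w v"
    using assms by (auto simp: lorentzian_form_def)
  obtain e1 e2 e3 where e: "B e1 e2 = 0" "B e1 e3 = 0" "B e2 e3 = 0"
    "B e1 e1 > 0" "B e2 e2 > 0" "B e3 e3 < 0"
    using assms unfolding lorentzian_form_def by blast
  define A where "A = gram B"
  define E :: "real^3^3" where "E = vector [e1, e2, e3]"
  have expand: "v = (\<Sum>i\<in>UNIV. v$i *\<^sub>R axis i 1)" for v :: "real^3"
    by (simp add: vec_eq_iff forall_3 sum_3 axis_def)
  have gram: "B v w = (\<Sum>i\<in>UNIV. \<Sum>j\<in>UNIV. v$i * w$j * B (axis i 1) (axis j 1))" for v w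
    by (subst expand[of v], subst expand[of w])
      (simp add: bilinear_sum[OF B(1)] bilinear_lmul[OF B(1)] bilinear_rmul[OF B(1)]
        sum.cartesian_product ac_simps)
  have EAE: "(E ** A ** transpose E) $ i $ j = B (E$i) (E$j)" for i j
    unfolding gram[of "E$i" "E$j"]
    by (simp add: matrix_matrix_mult_def transpose_def A_def gram_def sum_3 algebra_simps)
  have "det (E ** A ** transpose E) = B e1 e1 * B e2 e2 * B e3 e3"
    using e B(2)[of e2 e1] B(2)[of e3 e1] B(2)[of e3 e2] by (simp add: det_3 EAE) (simp add: E_def)
  also have "\<dots> < 0" using e by (simp add: mult_pos_neg)
  finally have "det E ^ 2 * det A < 0" by (simp add: det_mul det_transpose power2_eq_square algebra_simps)
  then show ?thesis
    unfolding A_def[symmetric] by (simp add: mult_less_0_iff)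
qed

text \<open>The positive definite plane of \<open>e1\<close> and \<open>e2\<close> meets the ideal
  \<open>v$1 = 0\<close>: either \<open>e1\<close> lies in it, or the combination that cancels first
  coordinates is a positive vector.\<close>

lemma lorentzian_positive_in_plane:
  assumes "lorentzian_form B"
  shows "\<exists>v. v$1 = 0 \<and> B v v > 0"
proof -
  obtain e1 e2 where e: "B e1 e2 = 0" "B e2 e1 = 0" "B e1 e1 > 0" "B e2 e2 > 0"
    using assms unfolding lorentzian_form_def by metis
  have B: "bilinear B" using assms by (simp add: lorentzian_form_def)
  define v where "v = e2$1 *\<^sub>R e1 - e1$1 *\<^sub>R e2"
  have "B v v = (e2$1)^2 * B e1 e1 + (e1$1)^2 * B e2 e2"
    by (simp add: v_def bilinear_lsub[OF B] bilinear_rsub[OF B] bilinear_lmul[OF B] bilinear_rmul[OF B] e power2_eq_square)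
  then have "e1$1 = 0 \<or> B v v > 0"
    using e by (smt (verit) mult_nonneg_nonneg mult_pos_pos zero_le_power2 zero_less_power2)
  moreover have "v$1 = 0" by (simp add: v_def)
  ultimately show ?thesis using e(3) by blast
qed


lemma isometric_to_normal_form_ordered:
  assumes B: "lorentzian_form B"
    and order: "\<not> (B (axis 2 1) (axis 2 1) > 0 \<and> B (axis 3 1) (axis 3 1) < 0)"
      "\<not> (B (axis 2 1) (axis 2 1) = 0 \<and> B (axis 3 1) (axis 3 1) \<noteq> 0)"
  shows "\<exists>B'. lorentzian_form B' \<and> isometric_via_automorphism (left_metric B) (left_metric B')
    \<and> normal_form (gram B')"
proof -
  have bil: "bilinear B" and sym: "\<And>v w. B v w = B w v"
    using B by (auto simp: lorentzian_form_def)
  note bilinear = bilinear_ladd[OF bil] bilinear_radd[OF bil] bilinear_lmul[OF bil] bilinear_rmul[OF bil]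
  define x y z p r s where g: "x = B (axis 1 1) (axis 1 1)" "y = B (axis 1 1) (axis 2 1)"
    "z = B (axis 1 1) (axis 3 1)" "p = B (axis 2 1) (axis 2 1)" "r = B (axis 2 1) (axis 3 1)"
    "s = B (axis 3 1) (axis 3 1)"
  have g': "B (axis 2 1) (axis 1 1) = y" "B (axis 3 1) (axis 1 1) = z" "B (axis 3 1) (axis 2 1) = r"
    using sym g by auto
  have det: "x * (p * s - r^2) - y * (y * s - r * z) + z * (y * r - p * z) < 0"
    using lorentzian_gram_det_neg[OF B]
    by (simp add: gram_def det_3 g' flip: g) (simp add: algebra_simps power2_eq_square)
  obtain v where v: "v$1 = 0" "B v v > 0"
    using lorentzian_positive_in_plane[OF B] by blast
  \<comment> \<open>The coordinates \<open>v$2\<close> and \<open>v$3\<close> become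
    \<open>m\<close> and \<open>n\<close> in \<open>normal_form_exists\<close>.\<close>
  have "v = v$2 *\<^sub>R axis 2 1 + v$3 *\<^sub>R axis 3 1"
    using v(1) by (simp add: vec_eq_iff forall_3 axis_def)
  then have "B v v = B (v$2 *\<^sub>R axis 2 1 + v$3 *\<^sub>R axis 3 1) (v$2 *\<^sub>R axis 2 1 + v$3 *\<^sub>R axis 3 1)"
    by simp
  also have "\<dots> = p * (v$2)^2 + 2 * r * v$2 * v$3 + s * (v$3)^2"
    unfolding bilinear by (simp add: g' flip: g) (simp add: algebra_simps power2_eq_square)
  finally have "p * (v$2)^2 + 2 * r * v$2 * v$3 + s * (v$3)^2 > 0" using v(2) by simp
  from normal_form_exists[OF det this] order obtain a b c d where ab: "a \<noteq> 0" "b \<noteq> 0"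
    and nf: "normal_form (sym_matrix3 (x + 2 * c * y + 2 * d * z + c^2 * p + 2 * c * d * r + d^2 * s)
      (a * (y + c * p + d * r)) (b * (z + c * r + d * s)) (a^2 * p) (a * b * r) (b^2 * s))"
    unfolding g by blast
  define F where "F = sol_linear a b c d"
  have F: "F (axis 1 1) = axis 1 1 + c *\<^sub>R axis 2 1 + d *\<^sub>R axis 3 1"
    "F (axis 2 1) = a *\<^sub>R axis 2 1" "F (axis 3 1) = b *\<^sub>R axis 3 1"
    by (simp_all add: F_def sol_linear_def vec_eq_iff forall_3 axis_def)
  have "gram (\<lambda>v w. B (F v) (F w)) =
    sym_matrix3 (x + 2 * c * y + 2 * d * z + c^2 * p + 2 * c * d * r + d^2 * s)
      (a * (y + c * p + d * r)) (b * (z + c * r + d * s)) (a^2 * p) (a * b * r) (b^2 * s)"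
    by (simp add: vec_eq_iff forall_3 gram_def sym_matrix3_def matrix3_def F bilinear g' flip: g)
      (simp add: algebra_simps power2_eq_square)
  moreover have "bij F"
    unfolding F_def by (rule bijI') (metis sol_linear_inverse[OF ab])+
  then have "lorentzian_form (\<lambda>v w. B (F v) (F w))"
    using lorentzian_form_compose[OF B] linear_sol_linear by (simp add: F_def)
  ultimately show ?thesis
    using isometric_sol_linear[OF ab, of B c d] nf unfolding F_def by metis
qed

lemma isometric_to_normal_form:
  assumes B: "lorentzian_form B"
  shows "\<exists>B'. lorentzian_form B' \<and> isometric_via_automorphism (left_metric B) (left_metric B')
    \<and> normal_form (gram B')"
proof (cases "(B (axis 2 1) (axis 2 1) > 0 \<and> B (axis 3 1) (axis 3 1) < 0) \<or>
    (B (axis 2 1) (axis 2 1) = 0 \<and> B (axis 3 1) (axis 3 1) \<noteq> 0)")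
  case True
  \<comment> \<open>The swap exchanges the two diagonal entries on the ideal. The excluded patterns
    become \<open>p < 0\<close>, \<open>s > 0\<close> and \<open>p \<noteq> 0\<close>,
    \<open>s = 0\<close>, which are both admissible.\<close>
  define C where "C = (\<lambda>v w. B (sol_swap v) (sol_swap w))"
  have "lorentzian_form C"
    unfolding C_def by (rule lorentzian_form_compose[OF B linear_sol_swap bij_sol_swap])
  moreover have "sol_swap (axis 2 1) = axis 3 1" "sol_swap (axis 3 1) = axis 2 1"
    by (simp_all add: sol_swap_def vec_eq_iff forall_3 axis_def)
  then have "C (axis 2 1) (axis 2 1) = B (axis 3 1) (axis 3 1)"
    "C (axis 3 1) (axis 3 1) = B (axis 2 1) (axis 2 1)"
    by (simp_all add: C_def)
  ultimately obtain B' where "lorentzian_form B'" "normal_form (gram B')"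
    "isometric_via_automorphism (left_metric C) (left_metric B')"
    using isometric_to_normal_form_ordered[of C] True by force
  then show ?thesis using isometric_swap unfolding C_def by blast
next
  case False
  then show ?thesis using isometric_to_normal_form_ordered[OF B] by blast
qed

theorem theorem3p4:
  fixes h :: metric
  assumes "lorentzian_metric h" and "left_invariant h"
  shows "\<exists>h'. lorentzian_metric h' \<and> left_invariant h' \<and> isometric_via_automorphism h h' \<and>
    ((\<exists>u v. v > 0 \<and> u < v \<and> u^2 \<noteq> v^2 \<and>
        metric_matrix h' = matrix3 (4 / (u^2 - v^2))  0        0
                                   0                  1        (u / v)
                                   0                  (u / v)  1)
   \<or> (\<exists>u v. v > 0 \<and> u < v \<and> u^2 \<noteq> v^2 \<and>
        metric_matrix h' = matrix3 (4 / (v^2 - u^2))  0        0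
                                   0                  (u / v)  (-1)
                                   0                  (-1)     (u / v))
   \<or> (\<exists>u v. u > 0 \<and> v > 0 \<and>
        metric_matrix h' = matrix3 (1 / (u + v))  0          0
                                   0              (- v / u)  1
                                   0              1          1)
   \<or> (\<exists>u. u > 0 \<and>
        metric_matrix h' = matrix3 (1 / u)  0     0
                                   0        (-1)  0
                                   0        0     1)
   \<or> (\<exists>b. b > 0 \<and>
        metric_matrix h' = matrix3 0          0  (- 2 / b)
                                   0          1  1
                                   (- 2 / b)  1  1)
   \<or> (\<exists>l. l \<noteq> 0 \<and>
        metric_matrix h' = matrix3 (l^2)  0  0
                                   0      l  1
                                   0      1  0)
   \<or> metric_matrix h' = matrix3 0 0 1
                                0 1 0
                                1 0 0)"
proof -
  have h: "h = left_metric (h 0)"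
    using assms(2) by (rule left_invariant_eq_left_metric)
  have "lorentzian_form (h 0)"
    using assms(1) by (simp add: lorentzian_metric_def)
  then obtain B' where B': "lorentzian_form B'" "isometric_via_automorphism h (left_metric B')"
    "normal_form (metric_matrix (left_metric B'))"
    using isometric_to_normal_form h metric_matrix_left_metric by metis
  show ?thesis
    using B'(2) lorentzian_metric_left_metric[OF B'(1)] left_invariant_left_metric
      B'(3)[unfolded normal_form_def sym_matrix3_def]
    by blast
qed

end
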